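(* Let $G=(V,E)$ be a directed acyclic graph (DAG) with $V=[p]$, i.e. a directed graph containing all self-loops $i\to i$, $i\in[p]$, and no other directed cycles, and let $C\in\mathrm{PD}_p$. Then $\mathcal{M}_{G,C}$ is an algebraic, and thus closed, subset of $\mathrm{PD}_p$. If $G$ is complete, then $\mathcal{M}_{G,C}=\mathrm{PD}_p$.
   Context: $[p]=\{1,\dots,p\}$, and $\mathrm{PD}_p$ is the cone of real symmetric positive definite $p\times p$ matrices. A DAG is complete if there is an edge between every pair of distinct nodes. $\mathbb{R}^E$ is the space of real $p\times p$ matrices $M=(m_{ij})$ with $m_{ji}=0$ whenever $i\to j\notin E$. For $C\in\mathrm{PD}_p$, $\mathcal{M}_{G,C}=\{\Sigma\in\mathrm{PD}_p: M\Sigma+\Sigma M^\top=-C \text{ for some } M\in\mathbb{R}^E\}$. An algebraic subset of $\mathrm{PD}_p$ is the set of matrices in $\mathrm{PD}_p$ at which a given set of polynomials in the matrix entries vanishes; closed means closed relative to $\mathrm{PD}_p$. *)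

theory Defs
  imports "HOL-Analysis.Analysis"
begin

text \<open>
  The node set \<open>[p]\<close> is the finite index type \<open>'n\<close>, with \<open>p = CARD('n)\<close>.  A directed graph
  on it is its edge set \<open>E :: ('n \<times> 'n) set\<close>, where \<open>(i, j) \<in> E\<close> stands for \<open>i \<rightarrow> j\<close>.
\<close>

text \<open>Self-loops are required at every node, so acyclicity concerns the remaining edges.\<close>

definition DAG :: "('n::finite \<times> 'n) set \<Rightarrow> bool" where
  "DAG E \<longleftrightarrow> (\<forall>i. (i, i) \<in> E) \<and> acyclic (E - Id)"

definition complete_graph :: "('n::finite \<times> 'n) set \<Rightarrow> bool" where
  "complete_graph E \<longleftrightarrow> (\<forall>i j. i \<noteq> j \<longrightarrow> (i, j) \<in> E \<or> (j, i) \<in> E)"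

definition PD :: "(real^'n^'n) set" where
  "PD = {A. transpose A = A \<and> (\<forall>x. x \<noteq> 0 \<longrightarrow> x \<bullet> (A *v x) > 0)}"

text \<open>Note the transposition: the edge \<open>i \<rightarrow> j\<close> governs the entry in row \<open>j\<close> and column \<open>i\<close>.\<close>

definition graph_matrices :: "('n::finite \<times> 'n) set \<Rightarrow> (real^'n^'n) set" where
  "graph_matrices E = {M. \<forall>i j. (i, j) \<notin> E \<longrightarrow> M $ j $ i = 0}"

definition lyapunov_model :: "('n::finite \<times> 'n) set \<Rightarrow> real^'n^'n \<Rightarrow> (real^'n^'n) set" where
  "lyapunov_model E C =
     {S \<in> PD. \<exists>M \<in> graph_matrices E. M ** S + S ** transpose M = - C}"

text \<open>
  On \<open>real^'n^'n\<close> the bounded linear functionals are exactly the linear forms in the matrix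
  entries, so \<^const>\<open>real_polynomial_function\<close> describes exactly the polynomials in the entries.
  The set \<open>F\<close> of polynomials is arbitrary, as it may be for an algebraic set.
\<close>

definition algebraic_subset_PD :: "(real^'n^'n) set \<Rightarrow> bool" where
  "algebraic_subset_PD X \<longleftrightarrow>
     (\<exists>F. (\<forall>f \<in> F. real_polynomial_function f) \<and> X = {A \<in> PD. \<forall>f \<in> F. f A = 0})"

end

theory Submission
  imports Defs
begin

text \<open>
  Fix \<open>S \<in> PD\<close>.  The Lyapunov equations \<open>(M S + S M\<^sup>T)\<^sub>j\<^sub>k = - C\<^sub>j\<^sub>k\<close> at the edges \<open>k \<rightarrow> j\<close>, together with
  the equations \<open>M\<^sub>j\<^sub>k = 0\<close> at the non-edges, form a square linear system in the entries of \<open>M\<close> whose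
  coefficients are polynomials in \<open>S\<close>.  Its kernel is trivial: going through the nodes in a
  topological order, if the rows of \<open>M\<close> at the proper parents of \<open>j\<close> vanish, then the homogeneous
  edge equations at \<open>j\<close> give \<open>x\<^sup>T S x = 0\<close> for its row \<open>x\<close> of \<open>M\<close>, hence \<open>x = 0\<close>.  So by Cramer's rule the only candidate
  for \<open>M\<close> is a rational function of \<open>S\<close> without poles on \<open>PD\<close>, and \<open>S\<close> belongs to the model iff this
  candidate also satisfies the equations at the non-edges.  For a complete graph these follow by symmetry.
\<close>

section \<open>The Lyapunov operator and its injectivity on the edge equations\<close>

definition lyapunov_op :: "real^'n^'n \<Rightarrow> real^'n^'n \<Rightarrow> real^'n^'n" where
  "lyapunov_op S M = M ** S + S ** transpose M"

lemma lyapunov_op_nth: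
  "lyapunov_op S M $ j $ k = (\<Sum>a\<in>UNIV. M $ j $ a * S $ a $ k) + (\<Sum>b\<in>UNIV. S $ j $ b * M $ k $ b)"
  by (simp add: lyapunov_op_def matrix_matrix_mult_def transpose_def)

lemma PD_symmetric:
  assumes "S \<in> PD" shows "S $ i $ j = S $ j $ i"
proof -
  have "transpose S $ i $ j = S $ j $ i" by (simp add: transpose_def)
  then show ?thesis using assms by (simp add: PD_def)
qed

lemma lyapunov_op_symmetric:
  assumes "S \<in> PD" shows "lyapunov_op S M $ j $ k = lyapunov_op S M $ k $ j"
  using PD_symmetric[OF assms] by (simp add: lyapunov_op_nth mult.commute add.commute)

lemma lyapunov_model_iff:
  "S \<in> lyapunov_model E C \<longleftrightarrow> S \<in> PD \<and> (\<exists>M \<in> graph_matrices E. lyapunov_op S M = - C)"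
  by (simp add: lyapunov_model_def lyapunov_op_def)

lemma lyapunov_op_edges_injective:
  fixes E :: "('n::finite \<times> 'n) set"
  assumes E: "DAG E" and S: "S \<in> PD" and M: "M \<in> graph_matrices E"
    and zero: "\<And>j k. (k, j) \<in> E \<Longrightarrow> lyapunov_op S M $ j $ k = 0"
  shows "M = 0"
proof -
  have "wf (E - Id)"
    using E by (intro finite_acyclic_wf) (auto simp: DAG_def)
  then have "M $ j = 0" for j
  proof (induction j rule: wf_induct_rule)
    case (less j)
    \<comment> \<open>These are the summands of \<open>x\<^sup>T S x\<close> for the row
      \<open>x = M $ j\<close>. Each vanishes separately: at a non-edge by its first factor, at an
      edge by its second.\<close>
    have term_zero: "M $ j $ k * (\<Sum>a\<in>UNIV. M $ j $ a * S $ a $ k) = 0" for k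
    proof (cases "(k, j) \<in> E")
      case False
      then show ?thesis using M by (simp add: graph_matrices_def)
    next
      case True
      note eq = zero[OF True, unfolded lyapunov_op_nth]
      show ?thesis
      proof (cases "k = j")
        case True
        \<comment> \<open>At the self-loop both halves of the equation agree, so it says that twice
          the sum is zero.\<close>
        have "(\<Sum>b\<in>UNIV. S $ j $ b * M $ j $ b) = (\<Sum>a\<in>UNIV. M $ j $ a * S $ a $ j)"
          by (intro sum.cong) (simp_all add: PD_symmetric[OF S, of j] mult.commute)
        then show ?thesis using eq True by simp
      next
        case False
        \<comment> \<open>A proper parent \<open>k\<close> precedes \<open>j\<close> in
          \<open>E - Id\<close>, so only the first half of the equation survives.\<close>
        then have "M $ k = 0" using less True by blast
        then show ?thesis using eq by simp
      qed
    qed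
    have "M $ j \<bullet> (S *v M $ j) = (\<Sum>k\<in>UNIV. M $ j $ k * (\<Sum>a\<in>UNIV. M $ j $ a * S $ a $ k))"
      using PD_symmetric[OF S]
      by (simp add: inner_vec_def matrix_vector_mult_def mult.commute)
    also have "\<dots> = 0" by (simp add: term_zero)
    finally show ?case using S unfolding PD_def by force
  qed
  then show ?thesis by (simp add: vec_eq_iff)
qed

section \<open>The square linear system and Cramer's rule\<close>

text \<open>In the index type \<open>'n \<times> 'n\<close> the pair \<open>(j, k)\<close> stands for the matrix entry in row \<open>j\<close>, column \<open>k\<close>.\<close>

definition unvec :: "'a^('n::finite \<times> 'n) \<Rightarrow> 'a^'n^'n" where
  "unvec m = (\<chi> j k. m $ (j, k))"

text \<open>Rows index equations and columns index unknown entries of \<open>M\<close>. The two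
  coefficients are added because at a self-loop both fall on the same unknowns.\<close>

definition edge_system :: "('n::finite \<times> 'n) set \<Rightarrow> real^'n^'n \<Rightarrow> real^('n \<times> 'n)^('n \<times> 'n)" where
  "edge_system E S = (\<chi> p q.
     if (snd p, fst p) \<in> E
     then (if fst q = fst p then S $ snd q $ snd p else 0) + (if fst q = snd p then S $ fst p $ snd q else 0)
     else if q = p then 1 else 0)"

definition edge_rhs :: "('n::finite \<times> 'n) set \<Rightarrow> real^'n^'n \<Rightarrow> real^('n \<times> 'n)" where
  "edge_rhs E C = (\<chi> p. if (snd p, fst p) \<in> E then - C $ fst p $ snd p else 0)"

text \<open>The determinants of Cramer's rule before division by \<open>det A\<close>: unlike the
  solution, they are polynomial in the entries of \<open>A\<close> and \<open>b\<close>.\<close>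

definition cramer_numerator :: "'a::comm_ring_1^'n^'n \<Rightarrow> 'a^'n \<Rightarrow> 'a^'n" where
  "cramer_numerator A b = (\<chi> k. det (\<chi> i j. if j = k then b $ i else A $ i $ j))"

lemma sum_prod_fst_eq:
  fixes f :: "'n::finite \<Rightarrow> 'n \<Rightarrow> real"
  shows "(\<Sum>q\<in>UNIV. if fst q = j then f j (snd q) else 0) = (\<Sum>a\<in>UNIV. f j a)"
proof -
  have "(\<Sum>q\<in>UNIV. if fst q = j then f j (snd q) else 0)
      = (\<Sum>i\<in>UNIV. \<Sum>a\<in>UNIV. if i = j then f j a else 0)"
    by (simp add: UNIV_Times_UNIV[symmetric] sum.cartesian_product case_prod_beta' del: UNIV_Times_UNIV)
  also have "\<dots> = (\<Sum>i\<in>UNIV. if i = j then \<Sum>a\<in>UNIV. f j a else 0)"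
    by (intro sum.cong) auto
  finally show ?thesis by simp
qed

lemma edge_system_mult:
  "(edge_system E S *v m) $ (j, k) =
     (if (k, j) \<in> E then lyapunov_op S (unvec m) $ j $ k else m $ (j, k))"
proof (cases "(k, j) \<in> E")
  case True
  have "(edge_system E S *v m) $ (j, k) =
      (\<Sum>q\<in>UNIV. (if fst q = j then m $ (j, snd q) * S $ snd q $ k else 0)
               + (if fst q = k then S $ j $ snd q * m $ (k, snd q) else 0))"
    using True unfolding matrix_vector_mult_def edge_system_def
    by (auto intro!: sum.cong simp: algebra_simps)
  then show ?thesis
    using True
      sum_prod_fst_eq[of j "\<lambda>j a. m $ (j, a) * S $ a $ k"]
      sum_prod_fst_eq[of k "\<lambda>k b. S $ j $ b * m $ (k, b)"]
    by (simp add: sum.distrib lyapunov_op_nth unvec_def)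
next
  case False
  then show ?thesis
    by (simp add: matrix_vector_mult_def edge_system_def if_distrib[of "\<lambda>x. x * _"] cong: if_cong)
qed

lemma edge_system_solution_iff:
  "edge_system E S *v m = edge_rhs E C \<longleftrightarrow>
     unvec m \<in> graph_matrices E \<and> (\<forall>j k. (k, j) \<in> E \<longrightarrow> lyapunov_op S (unvec m) $ j $ k = - C $ j $ k)"
  unfolding vec_eq_iff[of "edge_system E S *v m"]
  by (auto simp: edge_system_mult edge_rhs_def graph_matrices_def unvec_def split: if_splits)

lemma det_edge_system_nonzero:
  assumes "DAG E" and "S \<in> PD"
  shows "det (edge_system E S) \<noteq> 0"
proof -
  have "m = 0" if "edge_system E S *v m = 0" for m
  proof -
    \<comment> \<open>A kernel vector solves the system with \<open>C = 0\<close>, so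
      \<open>edge_system_solution_iff\<close> applies to it.\<close>
    have "edge_rhs E 0 = 0" by (simp add: edge_rhs_def vec_eq_iff)
    with that have "edge_system E S *v m = edge_rhs E 0" by simp
    then have "unvec m = 0"
      unfolding edge_system_solution_iff
      using lyapunov_op_edges_injective[OF assms] by simp
    then show ?thesis by (simp add: unvec_def vec_eq_iff)
  qed
  then have "invertible (edge_system E S)"
    by (simp add: invertible_left_inverse matrix_left_invertible_ker)
  then show ?thesis by (simp add: invertible_det_nz)
qed

lemma edge_system_cramer:
  assumes "DAG E" and "S \<in> PD"
  shows "edge_system E S *v m = b \<longleftrightarrow>
     m = (1 / det (edge_system E S)) *\<^sub>R cramer_numerator (edge_system E S) b"
  by (subst cramer[OF det_edge_system_nonzero[OF assms]])
     (simp add: cramer_numerator_def vec_eq_iff)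

lemma lyapunov_op_scaleR: "lyapunov_op S (c *\<^sub>R M) = c *\<^sub>R lyapunov_op S M"
  by (simp add: vec_eq_iff lyapunov_op_nth sum_distrib_left algebra_simps)

text \<open>The determinant is nonzero on \<open>PD\<close>, so multiplying by it clears
  denominators and leaves an equivalent condition, polynomial in \<open>S\<close>.\<close>

lemma lyapunov_model_iff_cramer:
  assumes E: "DAG E" and S: "S \<in> PD"
  shows "S \<in> lyapunov_model E C \<longleftrightarrow>
    lyapunov_op S (unvec (cramer_numerator (edge_system E S) (edge_rhs E C)))
      + det (edge_system E S) *\<^sub>R C = 0"
proof -
  define d where "d = det (edge_system E S)"
  define n where "n = cramer_numerator (edge_system E S) (edge_rhs E C)"
  define m where "m = (1 / d) *\<^sub>R n"
  have d: "d \<noteq> 0" unfolding d_def by (rule det_edge_system_nonzero[OF E S])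
  have unique: "edge_system E S *v m' = edge_rhs E C \<longleftrightarrow> m' = m" for m'
    unfolding m_def n_def d_def by (rule edge_system_cramer[OF E S])
  have "S \<in> lyapunov_model E C \<longleftrightarrow> lyapunov_op S (unvec m) = - C"
  proof
    assume "S \<in> lyapunov_model E C"
    then obtain M where M: "M \<in> graph_matrices E" "lyapunov_op S M = - C"
      by (auto simp: lyapunov_model_iff)
    have vec: "unvec (\<chi> p. M $ fst p $ snd p) = M"
      by (simp add: unvec_def vec_eq_iff)
    \<comment> \<open>Any witness of membership, once flattened, solves the square system and hence
      is the Cramer solution.\<close>
    have "edge_system E S *v (\<chi> p. M $ fst p $ snd p) = edge_rhs E C"
      unfolding edge_system_solution_iff vec using M by simp
    then have "unvec m = M" using vec unique by simp
    with M show "lyapunov_op S (unvec m) = - C" by simp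
  next
    assume "lyapunov_op S (unvec m) = - C"
    moreover have "unvec m \<in> graph_matrices E"
      using unique[of m] edge_system_solution_iff by blast
    ultimately show "S \<in> lyapunov_model E C" using S by (auto simp: lyapunov_model_iff)
  qed
  also have "unvec m = (1 / d) *\<^sub>R unvec n"
    by (simp add: m_def unvec_def vec_eq_iff)
  also have "lyapunov_op S ((1 / d) *\<^sub>R unvec n) = - C \<longleftrightarrow> lyapunov_op S (unvec n) + d *\<^sub>R C = 0"
    using d by (simp add: lyapunov_op_scaleR vec_eq_iff field_simps add_eq_0_iff)
  finally show ?thesis unfolding n_def d_def .
qed

section \<open>Polynomial dependence on the entries of \<open>S\<close>\<close>

lemma real_polynomial_function_prod:
  assumes "finite I" and "\<And>i. i \<in> I \<Longrightarrow> real_polynomial_function (\<lambda>x. f x i)"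
  shows "real_polynomial_function (\<lambda>x. \<Prod>i\<in>I. f x i)"
  using assms
  by (induction I rule: finite_induct) (simp_all add: real_polynomial_function.intros)

text \<open>The Leibniz formula is a finite sum of products of entries.\<close>

lemma real_polynomial_function_det:
  fixes A :: "'a::real_normed_vector \<Rightarrow> real^'m^'m"
  assumes "\<And>i j. real_polynomial_function (\<lambda>x. A x $ i $ j)"
  shows "real_polynomial_function (\<lambda>x. det (A x))"
  unfolding det_def
  by (intro real_polynomial_function_sum real_polynomial_function.intros(2,4)
      real_polynomial_function_prod assms) auto

lemma real_polynomial_function_matrix_nth:
  "real_polynomial_function (\<lambda>S::real^'n^'m. S $ i $ j)"
  by (intro real_polynomial_function.intros(1) bounded_linear_compose[OF bounded_linear_vec_nth]
      bounded_linear_vec_nth)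

lemma real_polynomial_function_edge_system:
  "real_polynomial_function (\<lambda>S. edge_system E S $ p $ q)"
  by (cases "(snd p, fst p) \<in> E"; cases "fst q = fst p"; cases "fst q = snd p"; cases "q = p")
     (simp_all add: edge_system_def real_polynomial_function.intros(2-4) real_polynomial_function_matrix_nth)

lemma real_polynomial_function_edge_cramer_numerator:
  "real_polynomial_function (\<lambda>S. cramer_numerator (edge_system E S) b $ p)"
  unfolding cramer_numerator_def vec_lambda_beta
proof (rule real_polynomial_function_det)
  fix i j
  show "real_polynomial_function
      (\<lambda>S. (\<chi> i j. if j = p then b $ i else edge_system E S $ i $ j) $ i $ j)"
    \<comment> \<open>The replaced column does not depend on \<open>S\<close>.\<close>
    by (cases "j = p")
       (simp_all add: real_polynomial_function.intros(2) real_polynomial_function_edge_system)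
qed

lemma algebraic_subset_PD_closedin:
  assumes "algebraic_subset_PD X"
  shows "closedin (top_of_set PD) X"
proof -
  obtain F where F: "\<And>f. f \<in> F \<Longrightarrow> real_polynomial_function f"
    and X: "X = {A \<in> PD. \<forall>f \<in> F. f A = 0}"
    using assms unfolding algebraic_subset_PD_def by blast
  have "closed {A. f A = 0}" if "f \<in> F" for f
    using continuous_real_polymonial_function[OF F[OF that]]
    by (intro closed_Collect_eq continuous_intros continuous_at_imp_continuous_on) auto
  then have "closed (\<Inter>f\<in>F. {A. f A = 0})" by blast
  moreover have "X = PD \<inter> (\<Inter>f\<in>F. {A. f A = 0})" using X by auto
  ultimately show ?thesis by (metis closedin_closed_Int)
qed

section \<open>Algebraicity and the complete case\<close>

lemma algebraic_lyapunov_model: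
  assumes "DAG E"
  shows "algebraic_subset_PD (lyapunov_model E C)"
proof -
  define f where "f j k S =
    lyapunov_op S (unvec (cramer_numerator (edge_system E S) (edge_rhs E C))) $ j $ k
      + det (edge_system E S) * C $ j $ k" for j k S
  have "real_polynomial_function (f j k)" for j k
    unfolding f_def[abs_def] lyapunov_op_nth unvec_def vec_lambda_beta
    by (intro real_polynomial_function_sum real_polynomial_function.intros(2-)
        real_polynomial_function_matrix_nth real_polynomial_function_edge_cramer_numerator
        real_polynomial_function_det real_polynomial_function_edge_system) auto
  \<comment> \<open>Restricted to \<open>PD\<close>, since elsewhere the determinant can vanish, for
    instance at \<open>S = 0\<close>.\<close>
  moreover have iff: "S \<in> lyapunov_model E C \<longleftrightarrow> (\<forall>j k. f j k S = 0)" if "S \<in> PD" for S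
    unfolding lyapunov_model_iff_cramer[OF assms that] by (simp add: f_def vec_eq_iff)
  have "lyapunov_model E C = {S \<in> PD. \<forall>g \<in> range (case_prod f). g S = 0}"
  proof (intro set_eqI iffI)
    fix S assume S: "S \<in> lyapunov_model E C"
    then have "S \<in> PD" by (simp add: lyapunov_model_iff)
    with S iff show "S \<in> {S \<in> PD. \<forall>g \<in> range (case_prod f). g S = 0}" by auto
  qed (simp add: iff)
  ultimately show ?thesis
    unfolding algebraic_subset_PD_def by (intro exI[of _ "range (case_prod f)"]) auto
qed

lemma lyapunov_model_complete_graph:
  assumes E: "DAG E" and C: "C \<in> PD" and complete: "complete_graph E"
  shows "lyapunov_model E C = PD"
proof
  show "lyapunov_model E C \<subseteq> PD" by (auto simp: lyapunov_model_def)
  show "PD \<subseteq> lyapunov_model E C"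
  proof
    fix S :: "real^'a^'a" assume S: "S \<in> PD"
    obtain m where "edge_system E S *v m = edge_rhs E C"
      using edge_system_cramer[OF E S] by blast
    then have M: "unvec m \<in> graph_matrices E"
      and edge: "\<And>j k. (k, j) \<in> E \<Longrightarrow> lyapunov_op S (unvec m) $ j $ k = - C $ j $ k"
      unfolding edge_system_solution_iff by auto
    have "lyapunov_op S (unvec m) $ j $ k = - C $ j $ k" for j k
    proof (cases "(k, j) \<in> E")
      case False
      \<comment> \<open>\<open>complete_graph\<close> is silent about \<open>j = k\<close>; there
        the self-loops of \<open>DAG\<close> rule out this case.\<close>
      then have "(j, k) \<in> E"
        using E complete unfolding DAG_def complete_graph_def by metis
      then show ?thesis
        using edge lyapunov_op_symmetric[OF S] PD_symmetric[OF C] by metis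
    qed (rule edge)
    then have "lyapunov_op S (unvec m) = - C" by (simp add: vec_eq_iff)
    with S M show "S \<in> lyapunov_model E C" by (auto simp: lyapunov_model_iff)
  qed
qed

theorem corollary24:
  fixes E :: "('n::finite \<times> 'n) set" and C :: "real^'n^'n"
  assumes "DAG E" and "C \<in> PD"
  shows "algebraic_subset_PD (lyapunov_model E C)
    \<and> closedin (top_of_set PD) (lyapunov_model E C)
    \<and> (complete_graph E \<longrightarrow> lyapunov_model E C = PD)"
  using algebraic_lyapunov_model[OF assms(1)] lyapunov_model_complete_graph[OF assms]
  by (auto intro: algebraic_subset_PD_closedin)

end
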